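(* Let $Q\subset\mathbb{R}^n$ be a closed convex set, let $L>0$ and $\delta\ge 0$, and let $f:Q\to\mathbb{R}$ be a locally Lipschitz quasiconvex functional having $(\delta,L)$-Lipschitz subgradient, i.e. $f\in C^{1,1}_{L,\delta}(Q)$. Then for arbitrary $x,y\in Q$ the inequality $$\bigl|f(y)-f(x)-\langle\hat{\partial}f(x),y-x\rangle\bigr|\le\frac{L}{2}\|y-x\|^2+\delta\|y-x\|$$ holds for some subgradient $\hat{\partial}f(x)\in\partial_{Cl}f(x)$.
   Context: $\|\cdot\|$ is a norm on the finite-dimensional space $E=\mathbb{R}^n$; $E^*$ is the dual space with the dual norm $\|y\|_*=\max\{\langle y,x\rangle:\|x\|\le 1\}$, where $\langle y,x\rangle$ is the value of the linear functional $y$ at $x$. A functional $f:Q\to\mathbb{R}$ is quasiconvex if $f((1-t)x+ty)\le\max\{f(x),f(y)\}$ for all $x,y\in Q$, $t\in[0,1]$. Clarke subdifferential: for a point $x_0$ and a direction $h$ put $$f^{\uparrow}_{Cl}(x_0;h)=\limsup_{x'\to x_0,\ \alpha\downarrow 0}\frac{1}{\alpha}\bigl[f(x'+\alpha h)-f(x')\bigr],\qquad \partial_{Cl}f(x_0)=\{v:\ f^{\uparrow}_{Cl}(x_0;g)\ge\langle v,g\rangle\ \ \forall g\in\mathbb{R}^n\}.$$ Elements of $\partial_{Cl}f(x_0)$ are called subgradients of $f$ at $x_0$ and are denoted $\hat\partial f(x_0)$. Put $\operatorname{diam}\partial_{Cl}f(x)=\max\{\|y-z\|_*: y,z\in\partial_{Cl}f(x)\}$.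 For fixed $x,y\in Q$ and $t\in[0,1]$ write $y_t=(1-t)x+ty$. Let $Q_0\subset Q$ denote the (countable) set of points where $f$ is not differentiable; for every $x\in Q_0$ the Clarke subdifferential $\partial_{Cl}f(x)$ is assumed to exist and be compact. Definition. A quasiconvex locally Lipschitz functional $f:Q\to\mathbb{R}$ has $(\delta,L)$-Lipschitz subgradient (written $f\in C^{1,1}_{L,\delta}(Q)$) if: (i) for arbitrary $x,y\in Q$, $f$ is differentiable at all points of the set $\{y_t\}_{0\le t\le 1}$ except for a (possibly finite) sequence $\{y_{t_k}\}_{k\ge 1}$ with $t_1<t_2<t_3<\dots$ and (if the sequence is infinite) $\lim_{k\to\infty}t_k=1$; (ii) at the points of the sequence in (i) the Clarke subdifferentials $\partial_{Cl}f(y_{t_k})$ exist and are bounded, $\operatorname{diam}\partial_{Cl}f(y_{t_k})=:\delta_k>0$, and $\sum_k\delta_k\le\delta<+\infty$; (iii) for arbitrary $x,y\in Q$ such that $y_t\in Q\setminus Q_0$ for every $t\in(0,1)$ (i.e. the gradient $\nabla f(y_t)$ exists), one has $$\min_{\hat{\partial}f(x)\in\partial_{Cl}f(x),\ \hat{\partial}f(y)\in\partial_{Cl}f(y)}\|\hat{\partial}f(x)-\hat{\partial}f(y)\|_*\le L\|x-y\|,$$ where the constant $L>0$ does not depend on the choice of $x$ and $y$.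
   Formalization: At points where f is differentiable, the subgradient in condition (iii) and in the conclusion must be the gradient rather than any element of the Clarke subdifferential; with arbitrary elements the claim fails for some differentiable f that are not strictly differentiable. *)

theory Defs
  imports "HOL-Analysis.Analysis"
begin

text \<open>
  The norm of the space is an arbitrary norm \<open>N\<close> on \<open>real ^ 'n\<close>. It need not be the Euclidean
  norm of that type, which is used only for the topology (all norms are equivalent) and for
  identifying linear functionals with vectors through the inner product.
\<close>

definition is_norm :: "(real ^ 'n \<Rightarrow> real) \<Rightarrow> bool" where
  "is_norm N \<longleftrightarrow>
     (\<forall>x. 0 \<le> N x) \<and> (\<forall>x. N x = 0 \<longleftrightarrow> x = 0) \<and>
     (\<forall>a x. N (a *\<^sub>R x) = \<bar>a\<bar> * N x) \<and> (\<forall>x y. N (x + y) \<le> N x + N y)"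

text \<open>The supremum is a maximum, since the unit ball of a norm is compact.\<close>

definition dual_norm :: "(real ^ 'n \<Rightarrow> real) \<Rightarrow> real ^ 'n \<Rightarrow> real" where
  "dual_norm N y = (SUP x\<in>{x. N x \<le> 1}. y \<bullet> x)"

definition quasiconvex_on :: "(real ^ 'n) set \<Rightarrow> (real ^ 'n \<Rightarrow> real) \<Rightarrow> bool" where
  "quasiconvex_on Q f \<longleftrightarrow>
     (\<forall>x\<in>Q. \<forall>y\<in>Q. \<forall>t\<in>{0..1}. f ((1 - t) *\<^sub>R x + t *\<^sub>R y) \<le> max (f x) (f y))"

definition locally_lipschitz_on :: "(real ^ 'n) set \<Rightarrow> (real ^ 'n \<Rightarrow> real) \<Rightarrow> bool" where
  "locally_lipschitz_on Q f \<longleftrightarrow> (\<forall>x\<in>Q. \<exists>e>0. \<exists>C. C-lipschitz_on (ball x e \<inter> Q) f)"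

text \<open>
  A functional on \<open>Q\<close> is represented by a total function whose values outside \<open>Q\<close> are irrelevant.
  Hence the upper limit in Clarke's derivative runs over those \<open>x'\<close> tending to \<open>x\<close> and those
  \<open>\<alpha>\<close> decreasing to \<open>0\<close> for which the difference quotient is defined, that is, for which both
  \<open>x'\<close> and \<open>x' + \<alpha> h\<close> lie in \<open>Q\<close>. At interior points of \<open>Q\<close> this is no restriction.
\<close>

definition clarke_filter :: "(real ^ 'n) set \<Rightarrow> real ^ 'n \<Rightarrow> real ^ 'n \<Rightarrow> ((real ^ 'n) \<times> real) filter" where
  "clarke_filter Q x h =
     inf (nhds x \<times>\<^sub>F at_right 0) (principal {(x', \<alpha>). x' \<in> Q \<and> x' + \<alpha> *\<^sub>R h \<in> Q})"

definition clarke_derivative ::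
    "(real ^ 'n) set \<Rightarrow> (real ^ 'n \<Rightarrow> real) \<Rightarrow> real ^ 'n \<Rightarrow> real ^ 'n \<Rightarrow> ereal" where
  "clarke_derivative Q f x h =
     Limsup (clarke_filter Q x h) (\<lambda>(x', \<alpha>). ereal ((f (x' + \<alpha> *\<^sub>R h) - f x') / \<alpha>))"

text \<open>
  If \<open>Q\<close> is convex with nonempty interior, then \<open>clarke_filter Q x g\<close> is nontrivial for all
  \<open>x \<in> Q\<close> and all \<open>g\<close>, so \<open>g\<close> ranges over the whole space. The guard only matters if
  \<open>Q\<close> lies in a proper affine subspace: a direction in which no difference quotient exists
  then imposes no condition.
\<close>

definition clarke_subdifferential ::
    "(real ^ 'n) set \<Rightarrow> (real ^ 'n \<Rightarrow> real) \<Rightarrow> real ^ 'n \<Rightarrow> (real ^ 'n) set" where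
  "clarke_subdifferential Q f x =
     {v. \<forall>g. clarke_filter Q x g \<noteq> bot \<longrightarrow> clarke_derivative Q f x g \<ge> ereal (v \<bullet> g)}"

text \<open>
  The supremum is a maximum for a nonempty compact set; the Clarke subdifferential is always closed.
\<close>

definition dual_diam :: "(real ^ 'n \<Rightarrow> real) \<Rightarrow> (real ^ 'n) set \<Rightarrow> real" where
  "dual_diam N A = (SUP (y, z)\<in>A \<times> A. dual_norm N (y - z))"

definition nondiff_points :: "(real ^ 'n) set \<Rightarrow> (real ^ 'n \<Rightarrow> real) \<Rightarrow> (real ^ 'n) set" where
  "nondiff_points Q f = {x \<in> Q. \<not> f differentiable (at x within Q)}"

text \<open>
  The elements of the Clarke subdifferential that are used as subgradients: at a point of
  differentiability the subgradient is the gradient. This has to be said explicitly, because there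
  the Clarke subdifferential contains the gradient but may be strictly larger if \<open>f\<close> is not
  strictly differentiable. For example, a Pompeiu function \<open>P\<close> (bounded derivative \<open>P' \<ge> 0\<close>
  that vanishes on a dense set, \<open>P\<close> strictly increasing) gives an everywhere differentiable
  increasing \<open>f\<close> with \<open>f' x = K \<bar>x\<bar> P' x\<close>, all of whose Clarke subdifferentials contain
  \<open>0\<close>. If elements other than the gradient were admitted, \<open>f\<close> would have a
  \<open>(0, L)\<close>-Lipschitz subgradient for every \<open>L > 0\<close>, although for large \<open>K\<close> it violates the
  quadratic bound at \<open>0\<close>, where its Clarke subdifferential is \<open>{0}\<close>.
\<close>

definition subgradients ::
    "(real ^ 'n) set \<Rightarrow> (real ^ 'n \<Rightarrow> real) \<Rightarrow> real ^ 'n \<Rightarrow> (real ^ 'n) set" where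
  "subgradients Q f x =
     {v \<in> clarke_subdifferential Q f x.
        x \<notin> nondiff_points Q f \<longrightarrow> (f has_derivative (\<lambda>h. v \<bullet> h)) (at x within Q)}"

text \<open>
  The class \<open>C\<^sup>1\<^sup>,\<^sup>1\<close> with parameters \<open>L\<close> and \<open>\<delta>\<close>. The sequence of exceptional parameters
  \<open>t\<^sub>k\<close> is indexed by \<open>K\<close>, either an initial segment of the natural numbers (possibly empty)
  or all of them. Exceptional points are compared as points of the segment rather than as parameters,
  so that the degenerate segment \<open>x = y\<close> at a point of nondifferentiability is covered. That
  the minimum over pairs of subgradients is at most \<open>L N (x - y)\<close> is expressed by a pair
  satisfying this bound.
\<close>

definition lipschitz_subgradient ::
    "(real ^ 'n \<Rightarrow> real) \<Rightarrow> (real ^ 'n) set \<Rightarrow> real \<Rightarrow> real \<Rightarrow> (real ^ 'n \<Rightarrow> real) \<Rightarrow> bool" where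
  "lipschitz_subgradient N Q L \<delta> f \<longleftrightarrow>
     quasiconvex_on Q f \<and> locally_lipschitz_on Q f \<and>
     countable (nondiff_points Q f) \<and>
     (\<forall>x\<in>nondiff_points Q f.
        clarke_subdifferential Q f x \<noteq> {} \<and> compact (clarke_subdifferential Q f x)) \<and>
     (\<forall>x\<in>Q. \<forall>y\<in>Q. \<exists>(K :: nat set) (t :: nat \<Rightarrow> real).
        ((\<exists>m. K = {..<m}) \<or> (K = UNIV \<and> t \<longlonglongrightarrow> 1)) \<and>
        strict_mono_on K t \<and> t ` K \<subseteq> {0..1} \<and>
        {(1 - s) *\<^sub>R x + s *\<^sub>R y |s. s \<in> {0..1}} \<inter> nondiff_points Q f =
          (\<lambda>k. (1 - t k) *\<^sub>R x + t k *\<^sub>R y) ` K \<and>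
        (\<forall>k\<in>K. clarke_subdifferential Q f ((1 - t k) *\<^sub>R x + t k *\<^sub>R y) \<noteq> {} \<and>
               bounded (clarke_subdifferential Q f ((1 - t k) *\<^sub>R x + t k *\<^sub>R y)) \<and>
               dual_diam N (clarke_subdifferential Q f ((1 - t k) *\<^sub>R x + t k *\<^sub>R y)) > 0) \<and>
        (\<lambda>k. dual_diam N (clarke_subdifferential Q f ((1 - t k) *\<^sub>R x + t k *\<^sub>R y))) summable_on K \<and>
        (\<Sum>\<^sub>\<infinity>k\<in>K. dual_diam N (clarke_subdifferential Q f ((1 - t k) *\<^sub>R x + t k *\<^sub>R y))) \<le> \<delta>) \<and>
     (\<forall>x\<in>Q. \<forall>y\<in>Q. (\<forall>t\<in>{0<..<1}. (1 - t) *\<^sub>R x + t *\<^sub>R y \<in> Q - nondiff_points Q f) \<longrightarrow>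
        (\<exists>u\<in>subgradients Q f x. \<exists>v\<in>subgradients Q f y. dual_norm N (u - v) \<le> L * N (x - y)))"

end

theory Submission
  imports Defs
begin

text \<open>
  Restrict \<open>f\<close> to the segment: put \<open>d = y - x\<close>, \<open>p s = x + s d\<close> and \<open>\<phi> s = f (p s)\<close>. At a parameter
  \<open>s\<close> where \<open>f\<close> is differentiable, every subgradient \<open>u\<close> at \<open>p s\<close> satisfies \<open>u \<bullet> d = \<phi>' s\<close>. At an
  exceptional parameter \<open>t\<^sub>k\<close> the numbers \<open>u \<bullet> d\<close> spread over a set of width at most
  \<open>\<delta>\<^sub>k N d\<close>, where \<open>\<delta>\<^sub>k\<close> is the diameter of the Clarke subdifferential, because
  \<open>u \<bullet> d \<le> dual_norm N u * N d\<close>. Between consecutive exceptional parameters the Lipschitz condition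
  on subgradients bounds the variation of the slope by \<open>L (N d)\<^sup>2\<close> times the length of the piece.

  Chaining the pieces (\<open>slope_chain\<close>) shows that for every subgradient \<open>v\<close> at \<open>x\<close> and every
  nonexceptional \<open>s < 1\<close>
  \<open>\<bar>\<phi>' s - v \<bullet> d\<bar> \<le> L (N d)\<^sup>2 s + \<delta> N d\<close>,
  since the exceptional parameters up to \<open>s\<close> are finite in number and their diameters add up to at
  most \<open>\<delta>\<close>. As \<open>\<phi>\<close> is continuous, integrating this bound over \<open>[0, 1]\<close>
  (\<open>remainder_le_of_derivative_bound\<close>) gives the inequality, and so it holds for all subgradients at
  \<open>x\<close>. One exists by \<open>subgradients_nonempty\<close>.
\<close>

section \<open>The dual norm and the diameter of a bounded set of functionals\<close>

lemma is_norm_zero: "is_norm N \<Longrightarrow> N 0 = 0"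
  unfolding is_norm_def by blast

text \<open>
  One half of the equivalence of norms. It makes the suprema in the dual norm and in the diameter
  finite; a real supremum of an unbounded set would carry no information.
\<close>

lemma norm_le_const_times_is_norm:
  fixes N :: "real ^ 'n \<Rightarrow> real"
  assumes "is_norm N"
  obtains B where "B > 0" "\<And>x. norm x \<le> B * N x"
proof -
  have nonneg: "0 \<le> N x" and zero: "N x = 0 \<longleftrightarrow> x = 0" and scale: "N (a *\<^sub>R x) = \<bar>a\<bar> * N x"
    and tri: "N (x + y) \<le> N x + N y" for x y a
    using assms unfolding is_norm_def by blast+
  have sum_le: "N (\<Sum>i\<in>I. g i) \<le> (\<Sum>i\<in>I. N (g i))" if "finite I"
    for I :: "'n set" and g
    using that
  proof (induction I rule: finite_induct)
    case empty
    then show ?case using zero[of 0] by simp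
  next
    case (insert i I)
    then show ?case using tri[of "g i" "\<Sum>i\<in>I. g i"] by simp
  qed
  define C where "C = (\<Sum>i\<in>(UNIV :: 'n set). N (axis i 1))"
  have le: "N x \<le> C * norm x" for x
  proof -
    have "N x = N (\<Sum>i\<in>UNIV. x $ i *\<^sub>R axis i 1)"
      using basis_expansion[of x] by (simp add: scalar_mult_eq_scaleR)
    also have "\<dots> \<le> (\<Sum>i\<in>UNIV. \<bar>x $ i\<bar> * N (axis i 1))"
      using sum_le[of UNIV "\<lambda>i. x $ i *\<^sub>R axis i 1"] by (simp add: scale)
    also have "\<dots> \<le> (\<Sum>i\<in>UNIV. norm x * N (axis i 1))"
      by (intro sum_mono mult_right_mono component_le_norm_cart nonneg)
    finally show ?thesis by (simp add: C_def sum_distrib_left mult.commute)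
  qed
  have "\<bar>N x - N y\<bar> \<le> C * norm (x - y)" for x y
    using tri[of "x - y" y] tri[of "y - x" x] le[of "x - y"] le[of "y - x"]
    by (simp add: norm_minus_commute abs_le_iff)
  then have "C-lipschitz_on UNIV N"
    by (intro lipschitz_onI) (auto simp: dist_norm C_def intro: sum_nonneg nonneg)
  then have "continuous_on (sphere 0 1) N"
    by (meson continuous_on_subset lipschitz_on_continuous_on subset_UNIV)
  moreover have "sphere (0 :: real ^ 'n) 1 \<noteq> {}" by simp
  ultimately obtain z where z: "z \<in> sphere 0 1" "\<And>x. x \<in> sphere 0 1 \<Longrightarrow> N z \<le> N x"
    using continuous_attains_inf[of "sphere 0 1" N] compact_sphere by blast
  have "z \<noteq> 0" using z(1) by auto
  then have pos: "N z > 0" using nonneg[of z] zero[of z] by linarith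
  have "norm x \<le> (1 / N z) * N x" for x
  proof (cases "x = 0")
    case False
    then have "N z \<le> N ((1 / norm x) *\<^sub>R x)" by (intro z(2)) simp
    also have "\<dots> = N x / norm x" by (simp add: scale)
    finally show ?thesis using False pos by (simp add: field_simps)
  qed (use nonneg pos in simp)
  then show ?thesis using that[of "1 / N z"] pos by simp
qed

lemma inner_le_const_on_unit_ball:
  assumes "\<And>x. norm x \<le> B * N x" "B > 0" "N x \<le> 1"
  shows "w \<bullet> x \<le> B * norm w"
proof -
  have "B * N x \<le> B * 1" using assms(2,3) by (intro mult_left_mono) auto
  then have "norm x \<le> B" using assms(1)[of x] by linarith
  then have "norm w * norm x \<le> norm w * B" by (simp add: mult_left_mono)
  then show ?thesis using norm_cauchy_schwarz[of w x] by (simp add: mult.commute)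
qed

lemma bdd_above_inner_unit_ball:
  assumes "is_norm N"
  shows "bdd_above ((\<lambda>x. w \<bullet> x) ` {x. N x \<le> 1})"
  by (rule norm_le_const_times_is_norm[OF assms])
    (auto intro!: bdd_aboveI2 inner_le_const_on_unit_ball)

lemma inner_le_dual_norm:
  assumes "is_norm N"
  shows "\<bar>w \<bullet> d\<bar> \<le> dual_norm N w * N d"
proof (cases "d = 0")
  case True
  then show ?thesis using is_norm_zero[OF assms] by simp
next
  case False
  have scale: "N (a *\<^sub>R x) = \<bar>a\<bar> * N x" for a x using assms by (simp add: is_norm_def)
  have pos: "N d > 0"
    using assms False unfolding is_norm_def by (metis order_less_le)
  have bound: "s * (w \<bullet> d) \<le> dual_norm N w * N d" if "\<bar>s\<bar> = 1" for s
  proof -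
    have "w \<bullet> ((s / N d) *\<^sub>R d) \<le> dual_norm N w"
      unfolding dual_norm_def
      by (rule cSUP_upper[OF _ bdd_above_inner_unit_ball[OF assms]]) (use pos that in \<open>simp add: scale\<close>)
    then show ?thesis using pos by (simp add: field_simps)
  qed
  show ?thesis using bound[of 1] bound[of "-1"] by simp
qed

lemma dual_norm_le_dual_diam:
  assumes "is_norm N" "bounded A" "u \<in> A" "v \<in> A"
  shows "dual_norm N (u - v) \<le> dual_diam N A"
proof -
  obtain B where B: "B > 0" "\<And>x. norm x \<le> B * N x"
    using norm_le_const_times_is_norm[OF assms(1)] by blast
  obtain R where R: "\<And>y. y \<in> A \<Longrightarrow> norm y \<le> R"
    using assms(2) unfolding bounded_iff by blast
  have "dual_norm N (y - z) \<le> B * (R + R)" if "y \<in> A" "z \<in> A" for y z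
  proof -
    have "{x. N x \<le> 1} \<noteq> {}"
      using is_norm_zero[OF assms(1)] by (auto intro!: exI[of _ 0])
    then have "dual_norm N (y - z) \<le> B * norm (y - z)"
      unfolding dual_norm_def
      by (rule cSUP_least) (auto intro: inner_le_const_on_unit_ball[OF B(2,1)])
    also have "\<dots> \<le> B * (R + R)"
      using B(1) R[OF that(1)] R[OF that(2)] norm_triangle_ineq4[of y z]
      by (intro mult_left_mono) auto
    finally show ?thesis .
  qed
  then have "bdd_above ((\<lambda>(y, z). dual_norm N (y - z)) ` (A \<times> A))"
    by (auto intro!: bdd_aboveI2)
  from cSUP_upper[OF _ this, of "(u, v)"] show ?thesis
    using assms(3,4) by (simp add: dual_diam_def)
qed

section \<open>Set-valued slopes with jumps\<close>

text \<open>
  \<open>G s\<close> is the set of slopes at the parameter \<open>s\<close>. Across an exceptional parameter \<open>c\<close> the selections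
  supplied by the two adjacent pieces may differ by the width \<open>w c\<close> of \<open>G c\<close>, so each exceptional
  parameter costs its width once. Keeping the existential form at the end points is what makes
  the bounds of two adjacent pieces add up without counting the common end point twice.
\<close>

lemma slope_chain:
  fixes G :: "real \<Rightarrow> real set" and w :: "real \<Rightarrow> real"
  assumes fin: "finite (E \<inter> {a<..<b})" and "A \<le> a" "a < b" "b \<le> B"
    and piece: "\<And>a b. A \<le> a \<Longrightarrow> a < b \<Longrightarrow> b \<le> B \<Longrightarrow> E \<inter> {a<..<b} = {} \<Longrightarrow>
                  \<exists>u\<in>G a. \<exists>v\<in>G b. \<bar>u - v\<bar> \<le> M * (b - a)"
    and width: "\<And>s u v. s \<in> {A..B} \<Longrightarrow> u \<in> G s \<Longrightarrow> v \<in> G s \<Longrightarrow> \<bar>u - v\<bar> \<le> w s"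
  shows "\<exists>u\<in>G a. \<exists>v\<in>G b. \<bar>u - v\<bar> \<le> sum w (E \<inter> {a<..<b}) + M * (b - a)"
  using fin \<open>A \<le> a\<close> \<open>a < b\<close> \<open>b \<le> B\<close>
proof (induction "card (E \<inter> {a<..<b})" arbitrary: a b rule: less_induct)
  case less
  show ?case
  proof (cases "E \<inter> {a<..<b} = {}")
    case True
    then show ?thesis using piece[of a b] less.prems by simp
  next
    case False
    then obtain c where c: "c \<in> E" "a < c" "c < b" by auto
    have split: "E \<inter> {a<..<b} = insert c (E \<inter> {a<..<c}) \<union> E \<inter> {c<..<b}"
      using c by auto
    have fins: "finite (E \<inter> {a<..<c})" "finite (E \<inter> {c<..<b})"
      using less.prems(1) unfolding split by auto
    have "E \<inter> {a<..<c} \<subset> E \<inter> {a<..<b}" "E \<inter> {c<..<b} \<subset> E \<inter> {a<..<b}"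
      using c by auto
    then have cards: "card (E \<inter> {a<..<c}) < card (E \<inter> {a<..<b})"
        "card (E \<inter> {c<..<b}) < card (E \<inter> {a<..<b})"
      using less.prems(1) psubset_card_mono by blast+
    obtain u p where l: "u \<in> G a" "p \<in> G c"
        "\<bar>u - p\<bar> \<le> sum w (E \<inter> {a<..<c}) + M * (c - a)"
      using less.hyps[OF cards(1) fins(1)] less.prems c by force
    obtain q v where r: "q \<in> G c" "v \<in> G b"
        "\<bar>q - v\<bar> \<le> sum w (E \<inter> {c<..<b}) + M * (b - c)"
      using less.hyps[OF cards(2) fins(2)] less.prems c by force
    have "\<bar>p - q\<bar> \<le> w c" using width[of c p q] l(2) r(1) c less.prems by simp
    moreover have "sum w (E \<inter> {a<..<b}) = w c + sum w (E \<inter> {a<..<c}) + sum w (E \<inter> {c<..<b})"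
      unfolding split using fins by (subst sum.union_disjoint) auto
    ultimately have "\<bar>u - v\<bar> \<le> sum w (E \<inter> {a<..<b}) + M * (b - a)"
      using l(3) r(3) by (simp add: algebra_simps)
    then show ?thesis using l(1) r(2) by blast
  qed
qed

text \<open>
  Exceptional parameters may accumulate at the right end only. So the fundamental theorem of calculus
  with finitely many exceptions applies on \<open>[0, T]\<close> for each \<open>T < 1\<close>, and continuity gives \<open>T = 1\<close>.
\<close>

lemma remainder_le_of_derivative_bound:
  fixes \<phi> :: "real \<Rightarrow> real"
  assumes cont: "continuous_on {0..1} \<phi>"
    and fin: "\<And>T. T < 1 \<Longrightarrow> finite (E \<inter> {0<..<T})"
    and deriv: "\<And>s. s \<in> {0<..<1} - E \<Longrightarrow>
                  \<exists>D. (\<phi> has_vector_derivative D) (at s) \<and> \<bar>D - c\<bar> \<le> M * s + B"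
    and "M \<ge> 0" "B \<ge> 0"
  shows "\<bar>\<phi> 1 - \<phi> 0 - c\<bar> \<le> M / 2 + B"
proof -
  obtain D where D: "\<And>s. s \<in> {0<..<1} - E \<Longrightarrow>
      (\<phi> has_vector_derivative D s) (at s) \<and> \<bar>D s - c\<bar> \<le> M * s + B"
    using deriv by metis
  define D' where "D' s = (if s \<in> {0<..<1} - E then D s - c else 0)" for s
  have before: "\<bar>\<phi> T - \<phi> 0 - c * T\<bar> - (M / 2 * T\<^sup>2 + B * T) \<le> 0" if T: "0 \<le> T" "T < 1" for T
  proof -
    have "(D' has_integral (\<phi> T - c * T) - (\<phi> 0 - c * 0)) {0..T}"
    proof (rule fundamental_theorem_of_calculus_interior_strong[OF fin[OF T(2)] T(1)])
      show "((\<lambda>s. \<phi> s - c * s) has_vector_derivative D' s) (at s)"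
        if "s \<in> {0<..<T} - E \<inter> {0<..<T}" for s
      proof -
        have s: "s \<in> {0<..<1} - E" using that T by auto
        have "((\<lambda>s. \<phi> s - c * s) has_vector_derivative D s - c) (at s)"
          using D[OF s] by (auto intro!: derivative_eq_intros)
        then show ?thesis using s unfolding D'_def by simp
      qed
      show "continuous_on {0..T} (\<lambda>s. \<phi> s - c * s)"
        using T by (intro continuous_intros continuous_on_subset[OF cont]) auto
    qed
    then have I: "(D' has_integral (\<phi> T - \<phi> 0 - c * T)) {0..T}"
      by (simp add: algebra_simps)
    have J: "((\<lambda>s. M * s + B) has_integral (M / 2 * T\<^sup>2 + B * T) - (M / 2 * 0\<^sup>2 + B * 0)) {0..T}"
      by (rule fundamental_theorem_of_calculus[OF T(1)])
        (auto intro!: derivative_eq_intros simp flip: has_real_derivative_iff_has_vector_derivative)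
    have "norm (integral {0..T} D') \<le> integral {0..T} (\<lambda>s. M * s + B)"
    proof (rule Henstock_Kurzweil_Integration.integral_norm_bound_integral)
      show "norm (D' s) \<le> M * s + B" if "s \<in> {0..T}" for s
        using that D[of s] assms(4,5) by (auto simp: D'_def)
    qed (use I J in auto)
    then show ?thesis using integral_unique[OF I] integral_unique[OF J] by simp
  qed
  have "\<bar>\<phi> 1 - \<phi> 0 - c * 1\<bar> - (M / 2 * 1\<^sup>2 + B * 1) \<le> 0"
    by (rule continuous_le_on_closure[where S = "{0..<1::real}" and x = 1
          and f = "\<lambda>T. \<bar>\<phi> T - \<phi> 0 - c * T\<bar> - (M / 2 * T\<^sup>2 + B * T)"])
      (use before in \<open>auto intro!: continuous_intros cont\<close>)
  then show ?thesis by simp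
qed

section \<open>Subgradients along a segment\<close>

text \<open>
  At a point of nondifferentiability the Clarke subdifferential is nonempty by assumption; at a point
  of differentiability the condition on pairs, applied to the degenerate segment, yields an element.
\<close>

lemma subgradients_nonempty:
  assumes "lipschitz_subgradient N Q L \<delta> f" "x \<in> Q"
  shows "subgradients Q f x \<noteq> {}"
proof (cases "x \<in> nondiff_points Q f")
  case True
  then show ?thesis using assms unfolding lipschitz_subgradient_def subgradients_def by blast
next
  case False
  have "(1 - t) *\<^sub>R x + t *\<^sub>R x = x" for t by (simp flip: scaleR_add_left)
  then show ?thesis using assms False unfolding lipschitz_subgradient_def
    by (metis (no_types, lifting) Diff_iff empty_iff)
qed

lemma locally_lipschitz_on_imp_continuous_on:
  assumes "locally_lipschitz_on Q f"
  shows "continuous_on Q f"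
  unfolding continuous_on_eq_continuous_within
proof
  fix x assume x: "x \<in> Q"
  then obtain e C where "e > 0" "C-lipschitz_on (ball x e \<inter> Q) f"
    using assms unfolding locally_lipschitz_on_def by blast
  then have "continuous (at x within ball x e \<inter> Q) f"
    using lipschitz_on_continuous_within x by fastforce
  moreover have "at x within ball x e \<inter> Q = at x within Q"
    using \<open>e > 0\<close> by (intro at_within_nhd[of x "ball x e"]) auto
  ultimately show "continuous (at x within Q) f" by simp
qed

text \<open>
  The derivative of \<open>f\<close> is taken within \<open>Q\<close> and need not be unique if \<open>Q\<close> is flat. Its value in the
  direction of the segment is unique nevertheless, being a derivative on a real interval; the end
  points are included for this reason.
\<close>

lemma subgradient_directional_derivative:
  fixes x y :: "real ^ 'n"
  defines "p \<equiv> \<lambda>s. (1 - s) *\<^sub>R x + s *\<^sub>R y"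
  assumes "convex Q" "x \<in> Q" "y \<in> Q" "s \<in> {0..1}" "p s \<notin> nondiff_points Q f"
    and "v \<in> subgradients Q f (p s)"
  shows "((\<lambda>s. f (p s)) has_vector_derivative v \<bullet> (y - x)) (at s within {0..1})"
proof -
  have "p ` {0..1} \<subseteq> Q"
    using assms(2-4) unfolding p_def by (auto intro!: convexD)
  moreover have "(f has_derivative (\<lambda>h. v \<bullet> h)) (at (p s) within Q)"
    using assms(6,7) by (simp add: subgradients_def)
  ultimately have f': "(f has_derivative (\<lambda>h. v \<bullet> h)) (at (p s) within p ` {0..1})"
    by (rule has_derivative_subset[rotated])
  have p': "(p has_derivative (\<lambda>h. h *\<^sub>R (y - x))) (at s within {0..1})"
    unfolding p_def by (auto intro!: derivative_eq_intros simp: algebra_simps)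
  from has_derivative_in_compose[OF p' f'] show ?thesis
    by (simp add: has_vector_derivative_def)
qed

theorem mainTheorem1:
  fixes N :: "real ^ 'n \<Rightarrow> real" and Q :: "(real ^ 'n) set" and f :: "real ^ 'n \<Rightarrow> real"
    and L \<delta> :: real and x y :: "real ^ 'n"
  assumes "is_norm N"
    and "closed Q" and "convex Q"
    and "L > 0" and "\<delta> \<ge> 0"
    and "locally_lipschitz_on Q f" and "quasiconvex_on Q f"
    and "lipschitz_subgradient N Q L \<delta> f"
    and "x \<in> Q" and "y \<in> Q"
  shows "\<exists>v\<in>subgradients Q f x.
           \<bar>f y - f x - v \<bullet> (y - x)\<bar> \<le> L / 2 * (N (y - x))\<^sup>2 + \<delta> * N (y - x)"
proof -
  obtain v where v: "v \<in> subgradients Q f x"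
    using subgradients_nonempty[OF assms(8,9)] by blast
  show ?thesis
  proof (cases "x = y")
    case True
    then show ?thesis using v is_norm_zero[OF assms(1)] by auto
  next
    case False
    define d where "d = y - x"
    define r where "r = N d"
    define p where "p = (\<lambda>s. (1 - s) *\<^sub>R x + s *\<^sub>R y)"
    define E where "E = {s \<in> {0..1}. p s \<in> nondiff_points Q f}"
    define diam where "diam = (\<lambda>s. dual_diam N (clarke_subdifferential Q f (p s)))"
    \<comment> \<open>an upper bound for the width of \<open>G s\<close>\<close>
    define w where "w = (\<lambda>s. if s \<in> E then diam s * r else 0)"
    define G where "G = (\<lambda>s. (\<lambda>v. v \<bullet> d) ` subgradients Q f (p s))"
    have scale: "N (a *\<^sub>R z) = \<bar>a\<bar> * N z" for a z
      using assms(1) by (simp add: is_norm_def)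
    have r0: "r \<ge> 0" using assms(1) by (simp add: is_norm_def r_def)
    have p_Q: "p s \<in> Q" if "s \<in> {0..1}" for s
      using that assms(3,9,10) unfolding p_def by (auto intro!: convexD)
    have p_eq: "p s = x + s *\<^sub>R d" for s by (simp add: p_def d_def algebra_simps)
    have inj_p: "s = s'" if "p s = p s'" for s s'
      using that False by (simp add: p_eq d_def)
    have pair: "\<exists>u\<in>subgradients Q f a. \<exists>v\<in>subgradients Q f b. dual_norm N (u - v) \<le> L * N (a - b)"
      if "a \<in> Q" "b \<in> Q" "\<forall>t\<in>{0<..<1}. (1 - t) *\<^sub>R a + t *\<^sub>R b \<in> Q - nondiff_points Q f" for a b
      using assms(8) that unfolding lipschitz_subgradient_def by blast
    obtain K :: "nat set" and t where
      K: "(\<exists>m. K = {..<m}) \<or> (K = UNIV \<and> t \<longlonglongrightarrow> 1)"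
      and mono: "strict_mono_on K t" and tK: "t ` K \<subseteq> {0..1}"
      and exc: "{p s |s. s \<in> {0..1}} \<inter> nondiff_points Q f = (\<lambda>k. p (t k)) ` K"
      and cl: "\<forall>k\<in>K. clarke_subdifferential Q f (p (t k)) \<noteq> {} \<and>
                 bounded (clarke_subdifferential Q f (p (t k))) \<and> diam (t k) > 0"
      and summ: "(\<lambda>k. diam (t k)) summable_on K"
      and infs: "(\<Sum>\<^sub>\<infinity>k\<in>K. diam (t k)) \<le> \<delta>"
      using assms(8)[unfolded lipschitz_subgradient_def, THEN conjunct2, THEN conjunct2,
          THEN conjunct2, THEN conjunct2, THEN conjunct1, THEN bspec, OF assms(9),
          THEN bspec, OF assms(10)]
      by (elim exE conjE) (rule that[unfolded p_def diam_def]; assumption)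
    have E_eq: "E = t ` K"
    proof
      show "E \<subseteq> t ` K"
      proof
        fix s assume "s \<in> E"
        then have "p s \<in> (\<lambda>k. p (t k)) ` K" unfolding exc[symmetric] E_def by auto
        then show "s \<in> t ` K" using inj_p by blast
      qed
      show "t ` K \<subseteq> E" using exc tK unfolding E_def by blast
    qed
    have fin: "finite (E \<inter> {0<..<T})" if "T < 1" for T
    proof -
      have "finite {k \<in> K. t k < T}"
        using K
      proof
        assume "K = UNIV \<and> t \<longlonglongrightarrow> 1"
        then have "eventually (\<lambda>k. t k > T) sequentially"
          using order_tendstoD(1) that by blast
        then obtain n where n: "\<And>k. k \<ge> n \<Longrightarrow> t k > T"
          unfolding eventually_sequentially by blast
        have "{k \<in> K. t k < T} \<subseteq> {..<n}"
          using n by (force simp: not_le[symmetric])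
        then show ?thesis using finite_subset by blast
      qed auto
      then have "finite (t ` {k \<in> K. t k < T})" by simp
      then show ?thesis
        by (rule finite_subset[rotated]) (auto simp: E_eq)
    qed
    have sum_le: "sum w F \<le> \<delta> * r" if F: "F \<subseteq> E" "finite F" for F
    proof -
      obtain K' where K': "K' \<subseteq> K" "finite K'" "F = t ` K'"
        using finite_subset_image[OF F(2), of t K] F(1) unfolding E_eq by metis
      have inj: "inj_on t K'"
        using strict_mono_on_imp_inj_on[OF mono] K'(1) inj_on_subset by blast
      have "sum diam F = (\<Sum>k\<in>K'. diam (t k))"
        unfolding K'(3) by (simp add: sum.reindex[OF inj])
      also have "\<dots> \<le> (\<Sum>\<^sub>\<infinity>k\<in>K. diam (t k))"
        using cl by (intro finite_sum_le_infsum summ K'(1,2)) (auto intro: less_imp_le)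
      finally have "sum diam F * r \<le> \<delta> * r" using infs r0 by (intro mult_right_mono) auto
      moreover have "sum w F = sum diam F * r"
        using F(1) by (auto simp: w_def sum_distrib_right intro!: sum.cong)
      ultimately show ?thesis by simp
    qed
    have width: "\<bar>a - b\<bar> \<le> w s" if s: "s \<in> {0..1}" and ab: "a \<in> G s" "b \<in> G s" for s a b
    proof -
      obtain g h where gh: "g \<in> subgradients Q f (p s)" "h \<in> subgradients Q f (p s)"
        "a = g \<bullet> d" "b = h \<bullet> d"
        using ab unfolding G_def by blast
      show ?thesis
      proof (cases "s \<in> E")
        case True
        then have "bounded (clarke_subdifferential Q f (p s))" using cl unfolding E_eq by blast
        then have "dual_norm N (g - h) \<le> diam s"
          using gh(1,2) unfolding diam_def subgradients_def
          by (intro dual_norm_le_dual_diam[OF assms(1)]) auto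
        then have "dual_norm N (g - h) * r \<le> diam s * r" using r0 by (rule mult_right_mono)
        then show ?thesis
          using inner_le_dual_norm[OF assms(1), of "g - h" d] True gh(3,4)
          by (simp add: w_def r_def inner_diff_left)
      next
        case False
        then have nd: "p s \<notin> nondiff_points Q f" using s by (simp add: E_def)
        have "((\<lambda>s. f (p s)) has_vector_derivative a) (at s within {0..1})"
             "((\<lambda>s. f (p s)) has_vector_derivative b) (at s within {0..1})"
          using subgradient_directional_derivative[OF assms(3,9,10) s] nd gh
          unfolding p_def d_def by blast+
        then have "a = b"
          using vector_derivative_unique_within_closed_interval[of 0 1 s] s by simp
        then show ?thesis using False by (simp add: w_def)
      qed
    qed
    have piece: "\<exists>u\<in>G a. \<exists>v\<in>G b. \<bar>u - v\<bar> \<le> L * r\<^sup>2 * (b - a)"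
      if ab: "0 \<le> a" "a < b" "b \<le> 1" and free: "E \<inter> {a<..<b} = {}" for a b
    proof -
      have "(1 - s) *\<^sub>R p a + s *\<^sub>R p b \<in> Q - nondiff_points Q f" if s: "s \<in> {0<..<1}" for s
      proof -
        define q where "q = a + s * (b - a)"
        have "s * (b - a) > 0" "s * (b - a) < 1 * (b - a)"
          using s ab by (auto intro!: mult_strict_right_mono)
        then have q: "q \<in> {a<..<b}" by (auto simp: q_def)
        have "(1 - s) *\<^sub>R p a + s *\<^sub>R p b = p q"
          by (simp add: p_eq q_def algebra_simps)
        moreover have "p q \<in> Q" using q ab by (intro p_Q) auto
        moreover have "q \<notin> E" using q free by blast
        ultimately show ?thesis using q ab by (auto simp: E_def)
      qed
      moreover have "p a \<in> Q" "p b \<in> Q" using ab by (auto intro!: p_Q)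
      ultimately obtain g h where gh: "g \<in> subgradients Q f (p a)" "h \<in> subgradients Q f (p b)"
        "dual_norm N (g - h) \<le> L * N (p a - p b)"
        using pair by blast
      have "p a - p b = (a - b) *\<^sub>R d" by (simp add: p_eq algebra_simps)
      then have "N (p a - p b) = (b - a) * r" using ab by (simp add: scale r_def)
      then have "dual_norm N (g - h) * r \<le> L * ((b - a) * r) * r"
        using gh(3) r0 by (intro mult_right_mono) auto
      then have "\<bar>g \<bullet> d - h \<bullet> d\<bar> \<le> L * r\<^sup>2 * (b - a)"
        using inner_le_dual_norm[OF assms(1), of "g - h" d]
        by (simp add: r_def inner_diff_left power2_eq_square algebra_simps)
      then show ?thesis using gh(1,2) unfolding G_def by blast
    qed
    have vG: "v \<bullet> d \<in> G 0" using v by (simp add: G_def p_eq)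
    have "\<bar>f (p 1) - f (p 0) - v \<bullet> d\<bar> \<le> L * r\<^sup>2 / 2 + \<delta> * r"
    proof (rule remainder_le_of_derivative_bound[where E = E])
      show "continuous_on {0..1} (\<lambda>s. f (p s))"
      proof (rule continuous_on_compose2[OF locally_lipschitz_on_imp_continuous_on[OF assms(6)]])
        show "continuous_on {0..1} p" unfolding p_def by (intro continuous_intros)
      qed (use p_Q in auto)
    next
      fix s assume s: "s \<in> {0<..<1} - E"
      have finE: "finite (E \<inter> {0<..<s})" using fin[of s] s by simp
      have "\<exists>a\<in>G 0. \<exists>b\<in>G s. \<bar>a - b\<bar> \<le> sum w (E \<inter> {0<..<s}) + L * r\<^sup>2 * (s - 0)"
      proof (rule slope_chain[where A = 0 and B = 1, OF finE])
        show "\<exists>u\<in>G a. \<exists>v\<in>G b. \<bar>u - v\<bar> \<le> L * r\<^sup>2 * (b - a)"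
          if "0 \<le> a" "a < b" "b \<le> 1" "E \<inter> {a<..<b} = {}" for a b
          by (fact piece[OF that])
        show "\<bar>u - v\<bar> \<le> w c" if "c \<in> {0..1}" "u \<in> G c" "v \<in> G c" for c u v
          by (fact width[OF that])
      qed (use s in auto)
      then obtain a b where ab: "a \<in> G 0" "b \<in> G s"
        "\<bar>a - b\<bar> \<le> sum w (E \<inter> {0<..<s}) + L * r\<^sup>2 * s"
        by auto
      \<comment> \<open>The chosen subgradient at \<open>x\<close> need not be the one at the start of the chain; if \<open>0\<close> is
        exceptional, replacing one by the other costs the width there, not yet counted.\<close>
      have "w 0 + sum w (E \<inter> {0<..<s}) \<le> \<delta> * r"
      proof (cases "0 \<in> E")
        case True
        then show ?thesis
          using sum_le[of "insert 0 (E \<inter> {0<..<s})"] finE by simp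
      next
        case False
        then show ?thesis using sum_le[of "E \<inter> {0<..<s}"] finE by (simp add: w_def)
      qed
      moreover have "\<bar>v \<bullet> d - a\<bar> \<le> w 0" using width[of 0] vG ab(1) by simp
      ultimately have bound: "\<bar>b - v \<bullet> d\<bar> \<le> L * r\<^sup>2 * s + \<delta> * r" using ab(3) by simp
      have s01: "s \<in> {0..1}" and nd: "p s \<notin> nondiff_points Q f" using s by (auto simp: E_def)
      have "((\<lambda>s. f (p s)) has_vector_derivative b) (at s within {0..1})"
        using subgradient_directional_derivative[OF assms(3,9,10) s01] nd ab(2)
        unfolding G_def p_def d_def by blast
      moreover have "at s within {0..1} = at s"
        using s by (intro at_within_interior) simp
      ultimately show "\<exists>D. ((\<lambda>s. f (p s)) has_vector_derivative D) (at s) \<and>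
          \<bar>D - v \<bullet> d\<bar> \<le> L * r\<^sup>2 * s + \<delta> * r"
        using bound by auto
    qed (use fin r0 assms(4,5) in auto)
    then show ?thesis
      using v by (intro bexI[of _ v]) (simp_all add: p_def d_def r_def)
  qed
qed

end
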